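(* If an algorithm for scheduling weighted jobs with online out-forest precedence constraints on $m$ parallel identical machines satisfies, at any time $t$ and for every $j\in F_t$, that \[R_j^t<1\ \Longrightarrow\ m\cdot\frac{w(S(j))}{W(t)}\le\rho\cdot R_j^t,\] where $R_j^t$ denotes the processing rate of $j$ at time $t$, then it is at most $(2+4\rho)$-competitive for minimizing the total weighted completion time.
   Context: Problem (non-clairvoyant scheduling with online precedence constraints on $m$ parallel identical machines): jobs $J$ with processing requirements $p_j\ge0$ and weights $w_j\ge0$; precedence DAG $G=(J,E)$ which is an out-forest (every job has at most one incoming edge). Time is discrete; at every time $t$ the algorithm assigns to each job a rate $R_j^t\in[0,1]$ with $\sum_jR_j^t\le m$ (such rates can be realized by an actual schedule on $m$ machines); $C_j$ is the first $t$ with $\sum_{t'\le t}R_j^{t'}\ge p_j$. Front jobs: $F_t=\{j: C_j>t,\ C_{j'}<t\ \forall(j',j)\in E\}$; only front jobs may receive positive rate. Jobs are revealed online when all predecessors are completed; processing requirements and $G$ are unknown. Objective: minimize $\sum_jw_jC_j$; $\rho'$-competitive means $\mathrm{Alg}\le\rho'\cdot\mathrm{Opt}$ always, where $\mathrm{Opt}$ is the offline optimum on the $m$ machines. $S(v)$ is $v$ with all its successors, $w(X)=\sum_{u\in X}w_u$, $U_t=\bigcup_{v\in F_t}S(v)$, $W(t)=w(U_t)$.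
   Formalization: Time slots start at 1; front jobs are those with C_j ≥ t instead of C_j > t (else no job with p_j > 0 could complete), and a job with p_j = 0 completes only after its predecessors have completed (else the bound fails); m ≥ 1 and ρ ≥ 0 are assumed. *)

theory Defs
  imports "HOL-Library.Extended_Nonnegative_Real" "HOL-Library.FuncSet"
begin

record 'a sched_instance =
  jobs :: "'a set"
  proc :: "'a \<Rightarrow> real"
  weight :: "'a \<Rightarrow> real"
  prec :: "('a \<times> 'a) set"

definition out_forest_instance :: "'a sched_instance \<Rightarrow> bool" where
  "out_forest_instance I \<longleftrightarrow>
     finite (jobs I) \<and>
     (\<forall>j\<in>jobs I. 0 \<le> proc I j \<and> 0 \<le> weight I j) \<and>
     prec I \<subseteq> jobs I \<times> jobs I \<and> acyclic (prec I) \<and>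
     (\<forall>i i' j. (i, j) \<in> prec I \<and> (i', j) \<in> prec I \<longrightarrow> i = i')"

text \<open>
  Time consists of the unit slots 1, 2, 3, ...; \<open>R t j\<close> is the rate of job \<open>j\<close> in slot \<open>t\<close>, and
  \<open>R 0\<close> is never used.  The set \<open>completed I R t\<close> consists of the jobs completed by the end of
  slot \<open>t\<close>.  The condition on the predecessors is needed only for jobs with processing
  requirement 0, which would otherwise complete in slot 1 even if their predecessors are
  unfinished; see \<open>completion_time_eq\<close> and \<open>completion_time_pos\<close> below.
\<close>

primrec completed :: "'a sched_instance \<Rightarrow> (nat \<Rightarrow> 'a \<Rightarrow> real) \<Rightarrow> nat \<Rightarrow> 'a set" where
  "completed I R 0 = {}"
| "completed I R (Suc t) = completed I R t \<union>
     {j \<in> jobs I. (\<forall>i. (i, j) \<in> prec I \<longrightarrow> i \<in> completed I R t) \<and>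
                  proc I j \<le> (\<Sum>s = 1..Suc t. R s j)}"

definition completion_time :: "'a sched_instance \<Rightarrow> (nat \<Rightarrow> 'a \<Rightarrow> real) \<Rightarrow> 'a \<Rightarrow> enat" where
  "completion_time I R j = Inf {enat t | t. j \<in> completed I R t}"

text \<open>
  A job that completes in slot \<open>t\<close> is still processed in slot \<open>t\<close>, hence the non-strict
  inequality for \<open>j\<close> itself.
\<close>

definition front :: "'a sched_instance \<Rightarrow> (nat \<Rightarrow> 'a \<Rightarrow> real) \<Rightarrow> nat \<Rightarrow> 'a set" where
  "front I R t = {j \<in> jobs I. enat t \<le> completion_time I R j \<and>
                     (\<forall>i. (i, j) \<in> prec I \<longrightarrow> completion_time I R i < enat t)}"

definition feasible :: "nat \<Rightarrow> 'a sched_instance \<Rightarrow> (nat \<Rightarrow> 'a \<Rightarrow> real) \<Rightarrow> bool" where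
  "feasible m I R \<longleftrightarrow>
     (\<forall>t\<ge>1. (\<forall>j\<in>jobs I. 0 \<le> R t j \<and> R t j \<le> 1) \<and>
            (\<Sum>j\<in>jobs I. R t j) \<le> real m \<and>
            (\<forall>j\<in>jobs I. 0 < R t j \<longrightarrow> j \<in> front I R t))"

definition total_cost :: "'a sched_instance \<Rightarrow> (nat \<Rightarrow> 'a \<Rightarrow> real) \<Rightarrow> ennreal" where
  "total_cost I R =
     (\<Sum>j\<in>jobs I. ennreal (weight I j) * ennreal_of_enat (completion_time I R j))"

definition opt :: "nat \<Rightarrow> 'a sched_instance \<Rightarrow> ennreal" where
  "opt m I = (INF R\<in>{R. feasible m I R}. total_cost I R)"

definition successors :: "'a sched_instance \<Rightarrow> 'a \<Rightarrow> 'a set" where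
  "successors I v = (prec I)\<^sup>* `` {v}"

definition total_weight :: "'a sched_instance \<Rightarrow> 'a set \<Rightarrow> real" where
  "total_weight I X = (\<Sum>u\<in>X. weight I u)"

definition front_weight :: "'a sched_instance \<Rightarrow> (nat \<Rightarrow> 'a \<Rightarrow> real) \<Rightarrow> nat \<Rightarrow> real" where
  "front_weight I R t = total_weight I (\<Union>v\<in>front I R t. successors I v)"

definition revealed :: "'a sched_instance \<Rightarrow> (nat \<Rightarrow> 'a \<Rightarrow> real) \<Rightarrow> nat \<Rightarrow> 'a set" where
  "revealed I R t = {j \<in> jobs I. \<forall>i. (i, j) \<in> prec I \<longrightarrow> completion_time I R i < enat t}"

text \<open>
  What is known at the beginning of slot \<open>t\<close>: the revealed jobs, their weights, the precedence
  edges between them, and which jobs were completed by the end of each earlier slot.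
\<close>

definition observed ::
  "'a sched_instance \<Rightarrow> (nat \<Rightarrow> 'a \<Rightarrow> real) \<Rightarrow> nat \<Rightarrow>
     'a set \<times> ('a \<Rightarrow> real) \<times> ('a \<times> 'a) set \<times> (nat \<Rightarrow> 'a set)" where
  "observed I R t =
     (revealed I R t, restrict (weight I) (revealed I R t),
      prec I \<inter> (revealed I R t \<times> revealed I R t), restrict (completed I R) {..<t})"

text \<open>
  An algorithm maps every instance to the rates it assigns.  Its rates in slot \<open>t\<close> may depend
  only on what has been observed so far and on side information \<open>pred I\<close> (a prediction, for
  example of the weights of the sets of successors).  A constant \<open>pred\<close> gives algorithms
  without side information.
\<close>

definition online_algorithm ::
  "nat \<Rightarrow> ('a sched_instance \<Rightarrow> 'p) \<Rightarrow> ('a sched_instance \<Rightarrow> nat \<Rightarrow> 'a \<Rightarrow> real) \<Rightarrow> bool" where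
  "online_algorithm m pred A \<longleftrightarrow>
     (\<forall>I. out_forest_instance I \<longrightarrow> feasible m I (A I)) \<and>
     (\<forall>I I' t. out_forest_instance I \<and> out_forest_instance I' \<and> 1 \<le> t \<and> pred I = pred I' \<and>
        observed I (A I) t = observed I' (A I') t \<longrightarrow>
        (\<forall>j\<in>revealed I (A I) t. A I t j = A I' t j))"

definition competitive ::
  "nat \<Rightarrow> ('a sched_instance \<Rightarrow> nat \<Rightarrow> 'a \<Rightarrow> real) \<Rightarrow> real \<Rightarrow> bool" where
  "competitive m A c \<longleftrightarrow>
     (\<forall>I. out_forest_instance I \<longrightarrow> total_cost I (A I) \<le> ennreal c * opt m I)"

lemma completed_mono: "s \<le> t \<Longrightarrow> completed I R s \<subseteq> completed I R t"
  by (rule lift_Suc_mono_le) auto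

lemma completion_time_le_iff: "completion_time I R j \<le> enat t \<longleftrightarrow> j \<in> completed I R t"
proof
  assume le: "completion_time I R j \<le> enat t"
  let ?S = "{enat t | t. j \<in> completed I R t}"
  have "?S \<noteq> {}"
    using le by (auto simp: completion_time_def Inf_enat_def split: if_splits)
  then have "Inf ?S \<in> ?S"
    unfolding Inf_enat_def by (simp only: if_False) (rule LeastI_ex, blast)
  then obtain s where "completion_time I R j = enat s" "j \<in> completed I R s"
    by (auto simp: completion_time_def)
  with le show "j \<in> completed I R t"
    using completed_mono[of s t I R] by auto
next
  assume "j \<in> completed I R t"
  then show "completion_time I R j \<le> enat t"
    by (auto simp: completion_time_def intro: Inf_lower)
qed

lemma completion_time_less_iff:
  "completion_time I R j < enat (Suc t) \<longleftrightarrow> j \<in> completed I R t"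
proof -
  have "x < enat (Suc t) \<longleftrightarrow> x \<le> enat t" for x
    by (cases x) auto
  then show ?thesis by (simp add: completion_time_le_iff)
qed

lemma completedD:
  "j \<in> completed I R t \<Longrightarrow>
     \<exists>s. 1 \<le> s \<and> s \<le> t \<and> (\<forall>i. (i, j) \<in> prec I \<longrightarrow> completion_time I R i < enat s) \<and>
         proc I j \<le> (\<Sum>u = 1..s. R u j)"
proof (induction t)
  case (Suc t)
  show ?case
  proof (cases "j \<in> completed I R t")
    case True
    with Suc.IH show ?thesis by (meson le_SucI)
  next
    case False
    with Suc.prems show ?thesis
      by (intro exI[of _ "Suc t"]) (auto simp: completion_time_less_iff)
  qed
qed simp

lemma completedI:
  assumes "j \<in> jobs I" "1 \<le> t" "\<forall>i. (i, j) \<in> prec I \<longrightarrow> completion_time I R i < enat t"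
    "proc I j \<le> (\<Sum>u = 1..t. R u j)"
  shows "j \<in> completed I R t"
  using assms by (cases t) (auto simp: completion_time_less_iff)

lemma completion_time_eq:
  assumes "j \<in> jobs I"
  shows "completion_time I R j =
    Inf {enat t | t. 1 \<le> t \<and> (\<forall>i. (i, j) \<in> prec I \<longrightarrow> completion_time I R i < enat t) \<and>
                     proc I j \<le> (\<Sum>s = 1..t. R s j)}"
    (is "_ = Inf ?S")
proof (rule antisym)
  show "completion_time I R j \<le> Inf ?S"
    by (rule Inf_greatest) (auto simp: completion_time_le_iff intro!: completedI assms)
  show "Inf ?S \<le> completion_time I R j"
    unfolding completion_time_def[of I R j]
  proof (rule Inf_greatest)
    fix x assume "x \<in> {enat t | t. j \<in> completed I R t}"
    then obtain t where t: "x = enat t" "j \<in> completed I R t" by blast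
    from completedD[OF t(2)] obtain s where s: "s \<le> t" "enat s \<in> ?S" by blast
    then have "Inf ?S \<le> enat s" by (intro Inf_lower)
    with s(1) t(1) show "Inf ?S \<le> x" by (simp add: order_trans)
  qed
qed

lemma completion_time_pos:
  assumes "feasible m I R" "j \<in> jobs I" "0 < proc I j"
  shows "completion_time I R j = Inf {enat t | t. 1 \<le> t \<and> proc I j \<le> (\<Sum>s = 1..t. R s j)}"
    (is "_ = Inf ?S")
proof (rule antisym)
  show "Inf ?S \<le> completion_time I R j"
    unfolding completion_time_eq[OF assms(2)] by (rule Inf_superset_mono) blast
  show "completion_time I R j \<le> Inf ?S"
  proof (rule Inf_greatest)
    fix x assume "x \<in> ?S"
    then obtain t where t: "x = enat t" "proc I j \<le> (\<Sum>s = 1..t. R s j)" by blast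
    define u where "u = (LEAST u. proc I j \<le> (\<Sum>s = 1..u. R s j))"
    have u: "proc I j \<le> (\<Sum>s = 1..u. R s j)" "u \<le> t"
      unfolding u_def using t(2) by (rule LeastI, rule Least_le)
    have "u \<noteq> 0" using u(1) assms(3) by (cases u) auto
    then obtain v where v: "u = Suc v" by (cases u) auto
    have "\<not> proc I j \<le> (\<Sum>s = 1..v. R s j)"
      using not_less_Least[of v "\<lambda>u. proc I j \<le> (\<Sum>s = 1..u. R s j)"] v
      unfolding u_def by simp
    with u(1) have "0 < R u j" by (simp add: v)
    with assms(1,2) v have "j \<in> front I R u" by (auto simp: feasible_def)
    then have "j \<in> completed I R u"
      using assms(2) u(1) v by (intro completedI) (auto simp: front_def)
    then have "completion_time I R j \<le> enat u" by (simp add: completion_time_le_iff)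
    with u(2) t(1) show "completion_time I R j \<le> x" by (simp add: order_trans)
  qed
qed

end

theory Submission
  imports Defs
begin

text \<open>
  The cost of a schedule \<open>R\<close> is the sum over all slots \<open>t\<close> of the unfinished weight \<open>W(t)\<close>, and the
  successor sets of the front jobs partition the unfinished jobs.  Fix a feasible schedule \<open>Q\<close> with
  completion times \<open>C*\<close> and cost \<open>K\<close>, and charge the weight \<open>w(S(i))\<close> of each front job \<open>i\<close> in slot
  \<open>t\<close> as follows.  If \<open>i\<close> runs at rate 1 or completes in slot \<open>t\<close>, the slot is charged to the slots in
  which \<open>Q\<close> has \<open>i\<close> at the front; along the chain leading to a job these are disjoint, so the charges
  sum to at most \<open>K\<close>.  Otherwise, if \<open>t < 2\<rho> C*(i)\<close>, then no job of \<open>S(i)\<close> is finished in \<open>Q\<close> before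
  time \<open>t / (2\<rho>)\<close>, and these charges sum to at most \<open>2\<rho> K\<close>.  In the remaining case the hypothesis
  gives \<open>w(S(i)) \<le> \<rho> R(t, i) W(t) / m\<close>, while the work done up to slot \<open>t\<close> on such jobs is at most
  \<open>m t / (2\<rho>)\<close>, since \<open>Q\<close> has finished them by time \<open>t / (2\<rho>)\<close>; as \<open>W\<close> is decreasing, summation
  by parts bounds these charges by half the cost of \<open>R\<close>.  Hence the cost of \<open>R\<close> is at most
  \<open>2 (1 + 2\<rho>) K\<close>.  The sums are truncated at a slot \<open>T\<close>, because the cost of \<open>R\<close> could a priori be infinite.
\<close>

section \<open>Front jobs as roots of the unfinished forest\<close>

lemma prec_completion_time_less:
  assumes "(i, v) \<in> prec I" and "completion_time I R v = enat c"
  shows "completion_time I R i < enat c"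
proof -
  have "v \<in> completed I R c"
    using assms(2) completion_time_le_iff[of I R v c] by simp
  from completedD[OF this] obtain s where "s \<le> c" "completion_time I R i < enat s"
    using assms(1) by blast
  then show ?thesis by (meson enat_ord_simps(1) less_le_trans)
qed

lemma prec_rtrancl_completion_time_le:
  assumes "(i, v) \<in> (prec I)\<^sup>*"
  shows "completion_time I R i \<le> completion_time I R v"
  using assms
proof (induction rule: rtrancl_induct)
  case (step y z)
  show ?case
  proof (cases "completion_time I R z")
    case (enat c)
    with prec_completion_time_less[OF step(2) enat] step(3) show ?thesis by simp
  qed simp
qed simp

lemma successors_subset_jobs:
  assumes "out_forest_instance I" "v \<in> jobs I"
  shows "successors I v \<subseteq> jobs I"
proof
  fix u assume "u \<in> successors I v"
  then have "(v, u) \<in> (prec I)\<^sup>*" by (simp add: successors_def)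
  then show "u \<in> jobs I"
    by (cases rule: rtranclE) (use assms in \<open>auto simp: out_forest_instance_def\<close>)
qed

text \<open>An unfinished job outside the front has an unfinished predecessor, and climbing stops
  because a finite acyclic relation is well-founded.\<close>

lemma exists_front_ancestor:
  assumes "out_forest_instance I" "v \<in> jobs I" "enat t \<le> completion_time I R v"
  shows "\<exists>i\<in>front I R t. v \<in> successors I i"
proof -
  have "wf (prec I)"
    using assms(1) by (intro finite_acyclic_wf)
      (auto simp: out_forest_instance_def intro: finite_subset finite_cartesian_product)
  then show ?thesis using assms(2,3)
  proof (induction v rule: wf_induct_rule)
    case (less v)
    show ?case
    proof (cases "v \<in> front I R t")
      case True
      then show ?thesis by (auto simp: successors_def)
    next
      case False
      with less.prems obtain i where i: "(i, v) \<in> prec I" "enat t \<le> completion_time I R i"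
        by (auto simp: front_def not_less)
      moreover have "i \<in> jobs I"
        using i assms(1) by (auto simp: out_forest_instance_def)
      ultimately obtain k where "k \<in> front I R t" "i \<in> successors I k"
        using less.IH by blast
      with i(1) show ?thesis
        by (auto simp: successors_def intro: rtrancl_into_rtrancl)
    qed
  qed
qed

text \<open>Completion times never decrease along edges, which gives one inclusion; climbing to a
  front ancestor gives the other. Thus W(t) is the weight unfinished at the start of slot
  \<open>t\<close>: it is nonincreasing and its sum over the slots is the cost.\<close>

lemma front_successors_eq:
  assumes "out_forest_instance I"
  shows "(\<Union>v\<in>front I R t. successors I v) = {v \<in> jobs I. enat t \<le> completion_time I R v}"
proof (intro equalityI subsetI)
  fix v assume "v \<in> (\<Union>v\<in>front I R t. successors I v)"
  then obtain i where i: "i \<in> front I R t" "v \<in> successors I i" by blast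
  then have "enat t \<le> completion_time I R v"
    using prec_rtrancl_completion_time_le[of i v I R]
    by (auto simp: front_def successors_def)
  moreover have "v \<in> jobs I"
    using i successors_subset_jobs[OF assms, of i] by (auto simp: front_def)
  ultimately show "v \<in> {v \<in> jobs I. enat t \<le> completion_time I R v}" by simp
qed (use exists_front_ancestor[OF assms] in blast)

text \<open>In-degree at most one makes the converse of \<open>prec I\<close> single-valued, so two
  ancestors of \<open>v\<close> lie on one chain. Two front jobs on a chain coincide, since a proper
  ancestor of a front job is finished before slot \<open>t\<close>.\<close>

lemma front_ancestor_unique:
  assumes "out_forest_instance I" "i \<in> front I R t" "k \<in> front I R t"
    "v \<in> successors I i" "v \<in> successors I k"
  shows "i = k"
proof -
  have no: "a = b" if a: "a \<in> front I R t" and b: "b \<in> front I R t" and ab: "(a, b) \<in> (prec I)\<^sup>*"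
    for a b
    using ab
  proof (cases rule: rtranclE)
    case (step y)
    have "completion_time I R y < enat t" using step b by (auto simp: front_def)
    with prec_rtrancl_completion_time_le[OF step(1), of R] have "completion_time I R a < enat t"
      by simp
    with a show ?thesis by (auto simp: front_def)
  qed simp
  have "single_valued ((prec I)\<inverse>)"
    using assms(1) unfolding out_forest_instance_def single_valued_def by blast
  moreover have "(v, i) \<in> ((prec I)\<inverse>)\<^sup>*" "(v, k) \<in> ((prec I)\<inverse>)\<^sup>*"
    using assms(4,5) by (auto simp: successors_def rtrancl_converse)
  ultimately have "(i, k) \<in> ((prec I)\<inverse>)\<^sup>* \<or> (k, i) \<in> ((prec I)\<inverse>)\<^sup>*"
    by (rule single_valued_confluent)
  then show ?thesis using no assms(2,3) by (auto simp: rtrancl_converse)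
qed

text \<open>Summed over slots, this gives the whole chain of ancestors of \<open>v\<close> at most
  as many front slots as the completion time of \<open>v\<close>.\<close>

lemma card_front_ancestors_le:
  assumes "out_forest_instance I"
  shows "card {i \<in> front I R t. v \<in> successors I i} \<le> (if enat t \<le> completion_time I R v then 1 else 0)"
proof (cases "\<exists>i. i \<in> front I R t \<and> v \<in> successors I i")
  case True
  then obtain i where i: "i \<in> front I R t" "v \<in> successors I i" by blast
  then have "{i \<in> front I R t. v \<in> successors I i} = {i}"
    using front_ancestor_unique[OF assms] by blast
  moreover have "enat t \<le> completion_time I R v"
    using i front_successors_eq[OF assms, of R t] by blast
  ultimately show ?thesis by simp
next
  case False
  then have "{i \<in> front I R t. v \<in> successors I i} = {}" by blast
  then show ?thesis by (simp only: card.empty le0)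
qed

section \<open>Work received by a single job\<close>

lemma work_before_completion_less:
  assumes "i \<in> front I R t" "1 \<le> t" "enat t < completion_time I R i"
  shows "(\<Sum>u = 1..t. R u i) < proc I i"
proof (rule ccontr)
  assume "\<not> ?thesis"
  with assms have "i \<in> completed I R t" by (intro completedI) (auto simp: front_def)
  with assms(3) completion_time_le_iff[of I R i t] show False by simp
qed

lemma work_before_completion_subset_le:
  assumes "feasible m I R" "i \<in> jobs I" "finite K" "K \<noteq> {}"
    "\<And>t. t \<in> K \<Longrightarrow> 1 \<le> t \<and> i \<in> front I R t \<and> enat t < completion_time I R i"
  shows "(\<Sum>t\<in>K. R t i) < proc I i"
proof -
  have M: "Max K \<in> K" using assms(3,4) by simp
  have "(\<Sum>t\<in>K. R t i) \<le> (\<Sum>u = 1..Max K. R u i)"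
    using assms by (intro sum_mono2) (auto simp: feasible_def)
  also have "\<dots> < proc I i"
    using assms(5)[OF M] by (intro work_before_completion_less) auto
  finally show ?thesis .
qed

lemma proc_le_work:
  assumes "feasible m I R" "i \<in> jobs I" "completion_time I R i \<le> enat c"
  shows "proc I i \<le> (\<Sum>u = 1..c. R u i)"
proof -
  have "i \<in> completed I R c" using assms(3) by (simp add: completion_time_le_iff)
  from completedD[OF this] obtain s where s: "s \<le> c" "proc I i \<le> (\<Sum>u = 1..s. R u i)" by blast
  have "(\<Sum>u = 1..s. R u i) \<le> (\<Sum>u = 1..c. R u i)"
    using assms s by (intro sum_mono2) (auto simp: feasible_def)
  with s(2) show ?thesis by simp
qed

text \<open>Work arrives only in front slots and at rate at most 1, hence the second bound. The
  first covers processing requirement 0: the completion slot is itself a front slot.\<close>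

lemma front_slots_bounds:
  assumes "feasible m I R" "i \<in> jobs I" "completion_time I R i \<le> enat c"
  shows "1 \<le> card {s \<in> {1..c}. i \<in> front I R s}"
    and "proc I i \<le> real (card {s \<in> {1..c}. i \<in> front I R s})"
proof -
  let ?S = "{s \<in> {1..c}. i \<in> front I R s}"
  obtain d where d: "completion_time I R i = enat d" "d \<le> c"
    using assms(3) by (cases "completion_time I R i") auto
  have "i \<in> completed I R d" using d completion_time_le_iff[of I R i d] by simp
  then have "1 \<le> d" by (cases d) auto
  moreover have "i \<in> front I R d"
    using assms(2) d(1) prec_completion_time_less[OF _ d(1)] by (auto simp: front_def)
  ultimately have "d \<in> ?S" using d by simp
  then have "0 < card ?S" by (auto simp: card_gt_0_iff)
  then show "1 \<le> card ?S" by linarith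
  have "proc I i \<le> (\<Sum>u = 1..c. R u i)" using assms by (rule proc_le_work)
  also have "\<dots> = (\<Sum>u\<in>?S. R u i)"
  proof (rule sum.mono_neutral_right)
    show "\<forall>u\<in>{1..c} - ?S. R u i = 0"
      using assms(1,2) by (fastforce simp: feasible_def)
  qed auto
  also have "\<dots> \<le> (\<Sum>u\<in>?S. 1)"
    using assms(1,2) by (intro sum_mono) (auto simp: feasible_def)
  finally show "proc I i \<le> real (card ?S)" by simp
qed

text \<open>
  Apart from the last one, the slots in which \<open>i\<close> runs at rate 1 under \<open>R\<close> number strictly less
  than \<open>proc I i\<close>.  Integrality therefore leaves room for the last slot, even if \<open>R\<close> overshoots
  the processing requirement in it.
\<close>

lemma card_fast_or_last_le:
  assumes "feasible m I R" "feasible m' I Q" "i \<in> jobs I" "completion_time I Q i \<le> enat c"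
  shows "card {t \<in> {1..T}. i \<in> front I R t \<and> (R t i = 1 \<or> completion_time I R i = enat t)}
    \<le> card {s \<in> {1..c}. i \<in> front I Q s}"
    (is "card ?A \<le> card ?B")
proof -
  note B = front_slots_bounds[OF assms(2-4)]
  let ?K = "{t \<in> {1..T}. i \<in> front I R t \<and> R t i = 1 \<and> enat t < completion_time I R i}"
  let ?L = "{t. completion_time I R i = enat t}"
  have L: "finite ?L" "card ?L \<le> 1"
    by (cases "completion_time I R i"; simp)+
  have "?A \<subseteq> ?K \<union> ?L"
    by (auto simp: front_def order.order_iff_strict)
  then have "card ?A \<le> card (?K \<union> ?L)"
    using L by (intro card_mono) auto
  also have "\<dots> \<le> card ?K + card ?L" by (rule card_Un_le)
  finally have A: "card ?A \<le> card ?K + 1" using L by simp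
  show ?thesis
  proof (cases "?K = {}")
    \<comment> \<open>Only the last slot can count here, and \<open>Q\<close> too has a front slot
      for \<open>i\<close>, even when \<open>proc I i\<close> is 0.\<close>
    case True
    with A B(1) show ?thesis by (simp only: card.empty)
  next
    case False
    have "real (card ?K) = (\<Sum>t\<in>?K. R t i)" by simp
    also have "\<dots> < proc I i"
      using assms(1,3) False by (intro work_before_completion_subset_le) auto
    also note B(2)
    finally have "card ?K < card ?B" by simp
    with A show ?thesis by simp
  qed
qed

section \<open>Summation by parts, volume bound, exchange of sums\<close>

lemma sum_mult_antimono_le:
  fixes W h :: "nat \<Rightarrow> real"
  assumes "\<And>t. 1 \<le> t \<Longrightarrow> W (Suc t) \<le> W t" "\<And>t. 0 \<le> W t"
    "\<And>t. (\<Sum>u = 1..t. h u) \<le> b * real t"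
  shows "(\<Sum>t = 1..T. W t * h t) \<le> b * (\<Sum>t = 1..T. W t)"
proof -
  let ?D = "\<lambda>t. b * real t - (\<Sum>u = 1..t. h u)"
  \<comment> \<open>Stronger than the claim: the accumulated slack, weighted by the current
    \<open>W T\<close>, is kept on the left. Replacing \<open>W T\<close> by
    \<open>W (Suc T)\<close> can only lower it, as the slack is nonnegative; at \<open>T = 0\<close>
    it is 0.\<close>
  have "W T * ?D T \<le> b * (\<Sum>t = 1..T. W t) - (\<Sum>t = 1..T. W t * h t)"
  proof (induction T)
    case (Suc T)
    have "W (Suc T) * ?D T \<le> W T * ?D T"
      using assms(1)[of T] assms(3)[of T] by (cases "T = 0") (auto intro: mult_right_mono)
    with Suc show ?case by (simp add: algebra_simps)
  qed simp
  moreover have "0 \<le> W T * ?D T" using assms(2,3) by simp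
  ultimately show ?thesis by linarith
qed

lemma sum_work_of_completed_le:
  assumes "feasible m I Q" "X \<subseteq> jobs I" "finite (jobs I)"
    "\<And>i. i \<in> X \<Longrightarrow> completion_time I Q i \<le> enat n"
  shows "(\<Sum>i\<in>X. proc I i) \<le> real m * real n"
proof -
  have "(\<Sum>i\<in>X. proc I i) \<le> (\<Sum>i\<in>X. \<Sum>u = 1..n. Q u i)"
    using assms by (intro sum_mono proc_le_work) auto
  also have "\<dots> \<le> (\<Sum>i\<in>jobs I. \<Sum>u = 1..n. Q u i)"
    using assms by (intro sum_mono2) (auto simp: feasible_def intro!: sum_nonneg)
  also have "\<dots> = (\<Sum>u = 1..n. \<Sum>i\<in>jobs I. Q u i)" by (rule sum.swap)
  also have "\<dots> \<le> (\<Sum>u = 1..n. real m)"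
    using assms by (intro sum_mono) (auto simp: feasible_def)
  finally show ?thesis by (simp add: mult.commute)
qed

text \<open>Moves the charge from \<open>i\<close> to the jobs \<open>v\<close> in its successor
  set; each \<open>v\<close> then sees only its ancestors in \<open>X\<close>.\<close>

lemma sum_total_weight_successors:
  assumes "out_forest_instance I" "X \<subseteq> jobs I"
  shows "(\<Sum>i\<in>X. total_weight I (successors I i) * f i) =
    (\<Sum>v\<in>jobs I. weight I v * (\<Sum>i\<in>{i\<in>X. v \<in> successors I i}. f i))"
proof -
  have fin: "finite (jobs I)" using assms(1) by (simp add: out_forest_instance_def)
  then have finX: "finite X" using assms(2) finite_subset by blast
  have "(\<Sum>i\<in>X. total_weight I (successors I i) * f i) =
      (\<Sum>i\<in>X. \<Sum>v\<in>{v\<in>jobs I. v \<in> successors I i}. weight I v * f i)"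
  proof (rule sum.cong)
    fix i assume "i \<in> X"
    then have "{v\<in>jobs I. v \<in> successors I i} = successors I i"
      using assms successors_subset_jobs[OF assms(1), of i] by auto
    then show "total_weight I (successors I i) * f i =
        (\<Sum>v\<in>{v\<in>jobs I. v \<in> successors I i}. weight I v * f i)"
      by (simp add: total_weight_def sum_distrib_right)
  qed simp
  also have "\<dots> = (\<Sum>v\<in>jobs I. \<Sum>i\<in>{i\<in>X. v \<in> successors I i}. weight I v * f i)"
    by (rule sum.swap_restrict[OF finX fin])
  finally show ?thesis by (simp add: sum_distrib_left)
qed

lemma total_weight_nonneg:
  assumes "out_forest_instance I" "X \<subseteq> jobs I"
  shows "0 \<le> total_weight I X"
  unfolding total_weight_def
  using assms by (intro sum_nonneg) (auto simp: out_forest_instance_def)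

section \<open>The three charges\<close>

lemma fast_or_last_weight_le:
  assumes I: "out_forest_instance I" and R: "feasible m I R" and Q: "feasible m' I Q"
    and fin: "\<And>v. v \<in> jobs I \<Longrightarrow> 0 < weight I v \<Longrightarrow> completion_time I Q v = enat (c v)"
  shows "(\<Sum>t = 1..T. \<Sum>i\<in>{i \<in> front I R t. R t i = 1 \<or> completion_time I R i = enat t}.
           total_weight I (successors I i)) \<le> (\<Sum>v\<in>jobs I. weight I v * real (c v))"
proof -
  have finJ: "finite (jobs I)" and w: "\<And>v. v \<in> jobs I \<Longrightarrow> 0 \<le> weight I v"
    using I by (auto simp: out_forest_instance_def)
  let ?P = "\<lambda>t i. i \<in> front I R t \<and> (R t i = 1 \<or> completion_time I R i = enat t)"
  let ?k = "\<lambda>i. real (card {t \<in> {1..T}. ?P t i})"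
  have "(\<Sum>t = 1..T. \<Sum>i\<in>{i \<in> front I R t. R t i = 1 \<or> completion_time I R i = enat t}.
           total_weight I (successors I i)) =
      (\<Sum>t = 1..T. \<Sum>i\<in>{i \<in> jobs I. ?P t i}. total_weight I (successors I i))"
    by (intro sum.cong) (auto simp: front_def)
  also have "\<dots> = (\<Sum>i\<in>jobs I. \<Sum>t\<in>{t \<in> {1..T}. ?P t i}. total_weight I (successors I i))"
    by (rule sum.swap_restrict) (use finJ in auto)
  also have "\<dots> = (\<Sum>i\<in>jobs I. total_weight I (successors I i) * ?k i)"
    by (simp add: mult.commute)
  also have "\<dots> = (\<Sum>v\<in>jobs I. weight I v * (\<Sum>i\<in>{i\<in>jobs I. v \<in> successors I i}. ?k i))"
    by (rule sum_total_weight_successors[OF I order_refl])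
  also have "\<dots> \<le> (\<Sum>v\<in>jobs I. weight I v * real (c v))"
  proof (rule sum_mono)
    fix v assume v: "v \<in> jobs I"
    show "weight I v * (\<Sum>i\<in>{i\<in>jobs I. v \<in> successors I i}. ?k i) \<le> weight I v * real (c v)"
    \<comment> \<open>\<open>fin\<close> determines \<open>c v\<close> only for positive weight;
      weight 0 makes both sides 0.\<close>
    proof (cases "weight I v = 0")
      case False
      with v w have cv: "completion_time I Q v = enat (c v)" using fin[of v] by fastforce
      let ?N = "{i\<in>jobs I. v \<in> successors I i}"
      \<comment> \<open>Every ancestor of \<open>v\<close> finishes under \<open>Q\<close> by
        \<open>c v\<close>, so its counted slots are outnumbered by its front slots there.\<close>
      have "(\<Sum>i\<in>?N. ?k i) \<le> (\<Sum>i\<in>?N. real (card {s \<in> {1..c v}. i \<in> front I Q s}))"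
        using cv prec_rtrancl_completion_time_le[of _ v I Q]
        by (intro sum_mono of_nat_mono card_fast_or_last_le[OF R Q]) (auto simp: successors_def)
      also have "\<dots> = (\<Sum>i\<in>?N. \<Sum>s\<in>{s \<in> {1..c v}. i \<in> front I Q s}. 1)" by simp
      also have "\<dots> = (\<Sum>s = 1..c v. \<Sum>i\<in>{i \<in> ?N. i \<in> front I Q s}. 1)"
        by (rule sum.swap_restrict) (use finJ in auto)
      also have "\<dots> = (\<Sum>s = 1..c v. real (card {i \<in> front I Q s. v \<in> successors I i}))"
        by (intro sum.cong) (auto simp: front_def intro!: arg_cong[where f = card])
      \<comment> \<open>Different ancestors of \<open>v\<close> never share a front slot of
        \<open>Q\<close>.\<close>
      also have "\<dots> \<le> (\<Sum>s = 1..c v. 1)"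
        using card_front_ancestors_le[OF I, of Q _ v]
        by (intro sum_mono) (smt (verit) of_nat_le_1_iff le_trans zero_le_one order_refl)
      finally show ?thesis using w[OF v] by (intro mult_left_mono) auto
    qed simp
  qed
  finally show ?thesis .
qed

lemma card_nat_less_real_le:
  fixes x :: real
  assumes "0 \<le> x"
  shows "real (card {t \<in> {1..T}. real t < x}) \<le> x"
proof -
  have "{t \<in> {1..T}. real t < x} \<subseteq> {1..nat \<lfloor>x\<rfloor>}"
    using le_nat_floor[OF less_imp_le] by auto
  then have "card {t \<in> {1..T}. real t < x} \<le> nat \<lfloor>x\<rfloor>"
    using card_mono[OF finite_atLeastAtMost] by (metis card_atLeastAtMost diff_Suc_1)
  then show ?thesis using assms by linarith
qed

text \<open>Quantifying over upper bounds \<open>n\<close> of the completion time admits jobs that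
  \<open>Q\<close> never completes; otherwise the condition is \<open>t < \<alpha> C*(i)\<close>. It
  passes to every successor \<open>v\<close>, which finishes no earlier than \<open>i\<close>. There
  are at most \<open>\<alpha> * c v\<close> such slots, and in each at most one \<open>i\<close>
  charges \<open>v\<close>.\<close>

lemma unfinished_weight_le:
  assumes I: "out_forest_instance I" and "0 \<le> \<alpha>"
    and fin: "\<And>v. v \<in> jobs I \<Longrightarrow> 0 < weight I v \<Longrightarrow> completion_time I Q v = enat (c v)"
  shows "(\<Sum>t = 1..T. \<Sum>i\<in>{i \<in> front I R t. \<forall>n. completion_time I Q i \<le> enat n \<longrightarrow> real t < \<alpha> * real n}.
           total_weight I (successors I i)) \<le> \<alpha> * (\<Sum>v\<in>jobs I. weight I v * real (c v))"
proof -
  have finJ: "finite (jobs I)" and w: "\<And>v. v \<in> jobs I \<Longrightarrow> 0 \<le> weight I v"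
    using I by (auto simp: out_forest_instance_def)
  let ?X = "\<lambda>t. {i \<in> front I R t. \<forall>n. completion_time I Q i \<le> enat n \<longrightarrow> real t < \<alpha> * real n}"
  have "(\<Sum>t = 1..T. \<Sum>i\<in>?X t. total_weight I (successors I i)) =
      (\<Sum>t = 1..T. \<Sum>v\<in>jobs I. weight I v * real (card {i \<in> ?X t. v \<in> successors I i}))"
  proof (rule sum.cong)
    fix t
    have "?X t \<subseteq> jobs I" by (auto simp: front_def)
    from sum_total_weight_successors[OF I this, of "\<lambda>_. 1"]
    show "(\<Sum>i\<in>?X t. total_weight I (successors I i)) =
      (\<Sum>v\<in>jobs I. weight I v * real (card {i \<in> ?X t. v \<in> successors I i}))"
      by simp
  qed simp
  also have "\<dots> \<le> (\<Sum>t = 1..T. \<Sum>v\<in>jobs I. weight I v * (if real t < \<alpha> * real (c v) then 1 else 0))"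
  proof (intro sum_mono)
    fix t v assume v: "v \<in> jobs I"
    let ?Y = "{i \<in> ?X t. v \<in> successors I i}"
    show "weight I v * real (card ?Y) \<le> weight I v * (if real t < \<alpha> * real (c v) then 1 else 0)"
    proof (cases "weight I v = 0 \<or> ?Y = {}")
      case True
      then show ?thesis using w[OF v] by (elim disjE) (simp, simp only: card.empty, simp)
    next
      case False
      with v w have cv: "completion_time I Q v = enat (c v)" using fin[of v] by fastforce
      from False obtain i where i: "i \<in> ?X t" "v \<in> successors I i" by blast
      then have "completion_time I Q i \<le> enat (c v)"
        using cv prec_rtrancl_completion_time_le[of i v I Q] by (auto simp: successors_def)
      with i have "real t < \<alpha> * real (c v)" by auto
      moreover have "?Y \<subseteq> {i}"
        using i front_ancestor_unique[OF I] by blast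
      then have "card ?Y \<le> 1"
        using card_mono[of "{i}" ?Y] by simp
      ultimately show ?thesis using w[OF v] by (simp add: mult_left_le)
    qed
  qed
  also have "\<dots> = (\<Sum>v\<in>jobs I. weight I v * real (card {t \<in> {1..T}. real t < \<alpha> * real (c v)}))"
    by (subst sum.swap) (simp add: sum_distrib_left[symmetric] sum.inter_filter[symmetric])
  also have "\<dots> \<le> (\<Sum>v\<in>jobs I. weight I v * (\<alpha> * real (c v)))"
    using w \<open>0 \<le> \<alpha>\<close> by (intro sum_mono mult_left_mono card_nat_less_real_le) auto
  also have "\<dots> = \<alpha> * (\<Sum>v\<in>jobs I. weight I v * real (c v))"
    by (simp add: sum_distrib_left mult_ac)
  finally show ?thesis .
qed

lemma front_weight_nonneg:
  "out_forest_instance I \<Longrightarrow> 0 \<le> front_weight I R t"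
  unfolding front_weight_def
  by (rule total_weight_nonneg) (auto simp: front_successors_eq)

lemma front_weight_Suc_le:
  assumes "out_forest_instance I"
  shows "front_weight I R (Suc t) \<le> front_weight I R t"
proof -
  have "enat t \<le> completion_time I R v" if "enat (Suc t) \<le> completion_time I R v" for v
    using that by (rule order_trans[rotated]) simp
  then show ?thesis
    using assms unfolding front_weight_def total_weight_def front_successors_eq[OF assms]
    by (intro sum_mono2) (auto simp: out_forest_instance_def)
qed

lemma successors_weight_le_front_weight:
  assumes "out_forest_instance I" "i \<in> front I R t"
  shows "total_weight I (successors I i) \<le> front_weight I R t"
proof -
  have "successors I i \<subseteq> (\<Union>v\<in>front I R t. successors I v)" using assms(2) by blast
  then show ?thesis
    using assms(1) unfolding front_weight_def total_weight_def front_successors_eq[OF assms(1)]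
    by (intro sum_mono2) (auto simp: out_forest_instance_def)
qed

text \<open>The threshold \<open>2 * \<rho>\<close> produces the factor 2: the hypothesis costs a
  factor \<open>\<rho>\<close>, while for positive \<open>\<rho>\<close> the volume bound gains
  \<open>1 / (2 * \<rho>)\<close>.\<close>

lemma slow_finished_weight_le:
  assumes I: "out_forest_instance I" and R: "feasible m I R" and Q: "feasible m I Q"
    and "1 \<le> m" "0 \<le> \<rho>"
    and slow: "\<And>t j. 1 \<le> t \<Longrightarrow> j \<in> front I R t \<Longrightarrow> R t j < 1 \<Longrightarrow>
       real m * (total_weight I (successors I j) / front_weight I R t) \<le> \<rho> * R t j"
  shows "2 * (\<Sum>t = 1..T. \<Sum>i\<in>{i \<in> front I R t. R t i < 1 \<and> enat t < completion_time I R i \<and>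
            (\<exists>n. completion_time I Q i \<le> enat n \<and> 2 * \<rho> * real n \<le> real t)}.
           total_weight I (successors I i)) \<le> (\<Sum>t = 1..T. front_weight I R t)"
proof -
  have finJ: "finite (jobs I)" and p: "\<And>v. v \<in> jobs I \<Longrightarrow> 0 \<le> proc I v"
    using I by (auto simp: out_forest_instance_def)
  let ?E = "\<lambda>t. {i \<in> jobs I. \<exists>n. completion_time I Q i \<le> enat n \<and> 2 * \<rho> * real n \<le> real t}"
  let ?P = "\<lambda>t i. i \<in> front I R t \<and> enat t < completion_time I R i"
  \<comment> \<open>Scaling the work on these jobs by \<open>2 * \<rho>\<close> makes
    \<open>m\<close> the bound per slot on average, also for \<open>\<rho> = 0\<close>.\<close>
  define h where "h t = 2 * \<rho> * (\<Sum>i\<in>{i \<in> ?E t. ?P t i}. R t i)" for t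
  let ?W = "front_weight I R"
  have partial: "(\<Sum>u = 1..t. h u) \<le> real m * real t" for t
  proof (cases "\<rho> = 0")
    case False
    then have \<rho>: "0 < \<rho>" using \<open>0 \<le> \<rho>\<close> by simp
    \<comment> \<open>\<open>?E u\<close> grows with \<open>u\<close>, so \<open>?E t\<close> serves
      for all slots up to \<open>t\<close>.\<close>
    have "(\<Sum>u = 1..t. \<Sum>i\<in>{i \<in> ?E u. ?P u i}. R u i) \<le> (\<Sum>u = 1..t. \<Sum>i\<in>{i \<in> ?E t. ?P u i}. R u i)"
      using R finJ by (intro sum_mono sum_mono2) (auto simp: feasible_def intro: order_trans)
    also have "\<dots> = (\<Sum>i\<in>?E t. \<Sum>u\<in>{u \<in> {1..t}. ?P u i}. R u i)"
      by (rule sum.swap_restrict) (use finJ in auto)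
    also have "\<dots> \<le> (\<Sum>i\<in>?E t. proc I i)"
    proof (rule sum_mono)
      fix i assume i: "i \<in> ?E t"
      show "(\<Sum>u\<in>{u \<in> {1..t}. ?P u i}. R u i) \<le> proc I i"
      proof (cases "{u \<in> {1..t}. ?P u i} = {}")
        case True
        show ?thesis unfolding True using i p by simp
      next
        case False
        with i show ?thesis
          by (intro less_imp_le work_before_completion_subset_le[OF R]) auto
      qed
    qed
    also have "\<dots> \<le> real m * real (nat \<lfloor>real t / (2 * \<rho>)\<rfloor>)"
    proof (rule sum_work_of_completed_le[OF Q _ finJ])
      fix i assume "i \<in> ?E t"
      then obtain n where n: "completion_time I Q i \<le> enat n" "2 * \<rho> * real n \<le> real t" by blast
      then have "real n \<le> real t / (2 * \<rho>)" using \<rho> by (simp add: field_simps)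
      then have "n \<le> nat \<lfloor>real t / (2 * \<rho>)\<rfloor>" by (rule le_nat_floor)
      with n(1) show "completion_time I Q i \<le> enat (nat \<lfloor>real t / (2 * \<rho>)\<rfloor>)"
        by (meson enat_ord_simps(1) order_trans)
    qed auto
    also have "\<dots> \<le> real m * (real t / (2 * \<rho>))"
      using \<rho> by (intro mult_left_mono of_nat_floor) auto
    finally show ?thesis
      using \<rho> unfolding h_def sum_distrib_left[symmetric] by (simp add: field_simps)
  qed (simp add: h_def)
  have step: "2 * real m * (\<Sum>i\<in>{i \<in> front I R t. R t i < 1 \<and> enat t < completion_time I R i \<and>
            (\<exists>n. completion_time I Q i \<le> enat n \<and> 2 * \<rho> * real n \<le> real t)}.
           total_weight I (successors I i)) \<le> ?W t * h t" (is "_ * sum _ ?S \<le> _") if t: "1 \<le> t" for t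
  proof -
    have W0: "0 \<le> ?W t" using I by (rule front_weight_nonneg)
    have "(\<Sum>i\<in>?S. 2 * real m * total_weight I (successors I i)) \<le> (\<Sum>i\<in>?S. ?W t * (2 * \<rho> * R t i))"
    proof (rule sum_mono)
      fix i assume i: "i \<in> ?S"
      show "2 * real m * total_weight I (successors I i) \<le> ?W t * (2 * \<rho> * R t i)"
      proof (cases "?W t = 0")
        \<comment> \<open>Division by 0 yields 0, so \<open>slow\<close> is uninformative here; but
          \<open>successors I i\<close> then has weight at most 0.\<close>
        case True
        moreover have "total_weight I (successors I i) \<le> ?W t"
          using i by (intro successors_weight_le_front_weight[OF I]) auto
        ultimately show ?thesis by (simp add: mult_nonneg_nonpos)
      next
        case False
        with W0 have "0 < ?W t" by simp
        with slow[OF t, of i] i show ?thesis by (simp add: field_simps)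
      qed
    qed
    also have "\<dots> \<le> (\<Sum>i\<in>{i \<in> ?E t. ?P t i}. ?W t * (2 * \<rho> * R t i))"
      using R finJ W0 \<open>0 \<le> \<rho>\<close> t
      by (intro sum_mono2) (auto simp: feasible_def front_def)
    finally show ?thesis by (simp add: h_def sum_distrib_left)
  qed
  have "2 * real m * (\<Sum>t = 1..T. \<Sum>i\<in>{i \<in> front I R t. R t i < 1 \<and> enat t < completion_time I R i \<and>
            (\<exists>n. completion_time I Q i \<le> enat n \<and> 2 * \<rho> * real n \<le> real t)}.
           total_weight I (successors I i)) \<le> (\<Sum>t = 1..T. ?W t * h t)"
    by (subst sum_distrib_left) (intro sum_mono step, simp)
  also have "\<dots> \<le> real m * (\<Sum>t = 1..T. ?W t)"
    using I partial by (intro sum_mult_antimono_le front_weight_Suc_le front_weight_nonneg)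
  finally show ?thesis using \<open>1 \<le> m\<close> by (simp add: mult.assoc mult.left_commute)
qed

lemma sum_front_weight_le:
  assumes I: "out_forest_instance I" and R: "feasible m I R" and Q: "feasible m I Q"
    and "1 \<le> m" "0 \<le> \<rho>"
    and slow: "\<And>t j. 1 \<le> t \<Longrightarrow> j \<in> front I R t \<Longrightarrow> R t j < 1 \<Longrightarrow>
       real m * (total_weight I (successors I j) / front_weight I R t) \<le> \<rho> * R t j"
    and fin: "\<And>v. v \<in> jobs I \<Longrightarrow> 0 < weight I v \<Longrightarrow> completion_time I Q v = enat (c v)"
  shows "(\<Sum>t = 1..T. front_weight I R t) \<le> (2 + 4 * \<rho>) * (\<Sum>v\<in>jobs I. weight I v * real (c v))"
proof -
  have finJ: "finite (jobs I)" using I by (simp add: out_forest_instance_def)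
  let ?A = "\<lambda>t. {i \<in> front I R t. R t i = 1 \<or> completion_time I R i = enat t}"
  let ?B = "\<lambda>t. {i \<in> front I R t. \<forall>n. completion_time I Q i \<le> enat n \<longrightarrow> real t < 2 * \<rho> * real n}"
  let ?C = "\<lambda>t. {i \<in> front I R t. R t i < 1 \<and> enat t < completion_time I R i \<and>
            (\<exists>n. completion_time I Q i \<le> enat n \<and> 2 * \<rho> * real n \<le> real t)}"
  let ?s = "\<lambda>i. total_weight I (successors I i)"
  have s: "0 \<le> ?s i" if "i \<in> front I R t" for i t
    using that I by (intro total_weight_nonneg successors_subset_jobs) (auto simp: front_def)
  have finF: "finite (front I R t)" for t
    using finJ by (rule rev_finite_subset) (auto simp: front_def)
  \<comment> \<open>\<open>?A\<close> and \<open>?B\<close> may overlap, hence subadditivity instead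
    of a disjoint sum.\<close>
  have un: "sum ?s (X \<union> Y) \<le> sum ?s X + sum ?s Y" if "X \<subseteq> front I R t" "Y \<subseteq> front I R t" for X Y t
  proof -
    have "finite X" "finite Y" using that finF finite_subset by blast+
    moreover have "0 \<le> sum ?s (X \<inter> Y)" using that s by (intro sum_nonneg) blast
    ultimately show ?thesis using sum.union_inter[of X Y ?s] by simp
  qed
  have split: "front_weight I R t \<le> sum ?s (?A t) + sum ?s (?B t) + sum ?s (?C t)" if "1 \<le> t" for t
  proof -
    have "front_weight I R t = sum ?s (front I R t)"
      unfolding front_weight_def total_weight_def
    proof (rule sum.UNION_disjoint)
      show "\<forall>i\<in>front I R t. finite (successors I i)"
        using finJ successors_subset_jobs[OF I] by (auto simp: front_def intro: finite_subset)
      show "\<forall>i\<in>front I R t. \<forall>j\<in>front I R t. i \<noteq> j \<longrightarrow> successors I i \<inter> successors I j = {}"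
        using front_ancestor_unique[OF I] by blast
    qed (rule finF)
    also have "\<dots> \<le> sum ?s (?A t \<union> ?B t \<union> ?C t)"
    proof (rule sum_mono2)
      have "R t i < 1 \<or> R t i = 1" if "i \<in> front I R t" for i
        using R that \<open>1 \<le> t\<close> by (auto simp: feasible_def front_def order.order_iff_strict)
      then show "front I R t \<subseteq> ?A t \<union> ?B t \<union> ?C t"
        by (auto simp: front_def not_less order.order_iff_strict)
    qed (use s finF in auto)
    also have "\<dots> \<le> sum ?s (?A t \<union> ?B t) + sum ?s (?C t)"
      by (rule un) auto
    also have "sum ?s (?A t \<union> ?B t) \<le> sum ?s (?A t) + sum ?s (?B t)"
      by (rule un) auto
    finally show ?thesis by simp
  qed
  have "(\<Sum>t = 1..T. front_weight I R t) \<le>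
      (\<Sum>t = 1..T. sum ?s (?A t)) + (\<Sum>t = 1..T. sum ?s (?B t)) + (\<Sum>t = 1..T. sum ?s (?C t))"
    unfolding sum.distrib[symmetric] by (intro sum_mono split) simp
  moreover have "(\<Sum>t = 1..T. sum ?s (?A t)) \<le> (\<Sum>v\<in>jobs I. weight I v * real (c v))"
    using I R Q fin by (rule fast_or_last_weight_le)
  moreover have "(\<Sum>t = 1..T. sum ?s (?B t)) \<le> 2 * \<rho> * (\<Sum>v\<in>jobs I. weight I v * real (c v))"
    using \<open>0 \<le> \<rho>\<close> by (intro unfinished_weight_le I fin) auto
  moreover have "2 * (\<Sum>t = 1..T. sum ?s (?C t)) \<le> (\<Sum>t = 1..T. front_weight I R t)"
    by (rule slow_finished_weight_le[OF I R Q \<open>1 \<le> m\<close> \<open>0 \<le> \<rho>\<close> slow])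
  \<comment> \<open>With S the truncated sum and K the weighted sum of the \<open>c v\<close>, the
    facts say S \<le> K + 2 \<rho> K + S / 2. Truncation makes S a real number, so S / 2 can be
    subtracted.\<close>
  ultimately show ?thesis by (simp add: algebra_simps)
qed

section \<open>The cost as the sum of the unfinished weights\<close>

lemma sum_front_weight_eq:
  assumes "out_forest_instance I"
  shows "(\<Sum>t = 1..T. front_weight I R t) =
    (\<Sum>v\<in>jobs I. weight I v * real (card {t \<in> {1..T}. enat t \<le> completion_time I R v}))"
proof -
  have finJ: "finite (jobs I)" using assms by (simp add: out_forest_instance_def)
  have "(\<Sum>t = 1..T. front_weight I R t) =
      (\<Sum>t = 1..T. \<Sum>v\<in>{v \<in> jobs I. enat t \<le> completion_time I R v}. weight I v)"
    by (simp add: front_weight_def total_weight_def front_successors_eq[OF assms])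
  also have "\<dots> = (\<Sum>v\<in>jobs I. \<Sum>t\<in>{t \<in> {1..T}. enat t \<le> completion_time I R v}. weight I v)"
    by (rule sum.swap_restrict) (use finJ in auto)
  finally show ?thesis by (simp add: mult.commute)
qed

lemma total_cost_eq_finite:
  assumes "out_forest_instance I"
    and "\<And>v. v \<in> jobs I \<Longrightarrow> 0 < weight I v \<Longrightarrow> completion_time I R v = enat (c v)"
  shows "total_cost I R = ennreal (\<Sum>v\<in>jobs I. weight I v * real (c v))"
proof -
  have w: "\<And>v. v \<in> jobs I \<Longrightarrow> 0 \<le> weight I v"
    using assms(1) by (auto simp: out_forest_instance_def)
  have "total_cost I R = (\<Sum>v\<in>jobs I. ennreal (weight I v * real (c v)))"
    unfolding total_cost_def
  proof (rule sum.cong)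
    fix v assume v: "v \<in> jobs I"
    show "ennreal (weight I v) * ennreal_of_enat (completion_time I R v) =
        ennreal (weight I v * real (c v))"
    proof (cases "weight I v = 0")
      case False
      with v w have "completion_time I R v = enat (c v)" using assms(2)[of v] by fastforce
      then show ?thesis using w[OF v] by (simp add: ennreal_mult ennreal_of_nat_eq_real_of_nat)
    qed simp
  qed simp
  also have "\<dots> = ennreal (\<Sum>v\<in>jobs I. weight I v * real (c v))"
    using w by (intro sum_ennreal) auto
  finally show ?thesis .
qed

lemma total_cost_eq_top:
  assumes "finite (jobs I)" "v \<in> jobs I" "0 < weight I v" "completion_time I R v = \<infinity>"
  shows "total_cost I R = top"
proof -
  have "ennreal (weight I v) * ennreal_of_enat (completion_time I R v) = top"
    using assms by (simp add: ennreal_mult_top)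
  with assms(1,2) show ?thesis
    unfolding total_cost_def by (metis ennreal_sum_eq_top)
qed

text \<open>A never-completed job of positive weight would make the truncated sums grow linearly in
  \<open>T\<close>. Hence all completion times that matter are finite, and one large
  \<open>T\<close> captures the whole cost.\<close>

lemma total_cost_le_of_partial_sums:
  assumes I: "out_forest_instance I" and K: "\<And>T. (\<Sum>t = 1..T. front_weight I R t) \<le> K"
  shows "total_cost I R \<le> ennreal K"
proof -
  have finJ: "finite (jobs I)" and w: "\<And>v. v \<in> jobs I \<Longrightarrow> 0 \<le> weight I v"
    using I by (auto simp: out_forest_instance_def)
  let ?n = "\<lambda>v T. real (card {t \<in> {1..T}. enat t \<le> completion_time I R v})"
  define c where "c v = the_enat (completion_time I R v)" for v
  have fin: "completion_time I R v = enat (c v)" if v: "v \<in> jobs I" "0 < weight I v" for v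
  proof (cases "completion_time I R v")
    case infinity
    obtain T :: nat where T: "K < real T * weight I v"
      using v(2) by (meson reals_Archimedean3)
    have "weight I v * ?n v T \<le> (\<Sum>v\<in>jobs I. weight I v * ?n v T)"
      using finJ w v by (intro member_le_sum) auto
    also have "\<dots> \<le> K" using K[of T] by (simp only: sum_front_weight_eq[OF I])
    also have "?n v T = real T" by (simp add: infinity del: atLeastAtMost_iff)
    finally show ?thesis using T by (simp add: mult.commute)
  qed (simp add: c_def)
  define T where "T = (\<Sum>v\<in>jobs I. c v)"
  have "(\<Sum>v\<in>jobs I. weight I v * real (c v)) = (\<Sum>v\<in>jobs I. weight I v * ?n v T)"
  proof (rule sum.cong)
    fix v assume v: "v \<in> jobs I"
    show "weight I v * real (c v) = weight I v * ?n v T"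
    proof (cases "weight I v = 0")
      case False
      with v w have cv: "completion_time I R v = enat (c v)" using fin[of v] by fastforce
      have "c v \<le> T" unfolding T_def using v finJ by (intro member_le_sum) auto
      then have "{t \<in> {1..T}. enat t \<le> completion_time I R v} = {1..c v}"
        by (auto simp: cv)
      then show ?thesis by simp
    qed simp
  qed simp
  also have "\<dots> \<le> K" using K[of T] by (simp only: sum_front_weight_eq[OF I])
  finally have "ennreal (\<Sum>v\<in>jobs I. weight I v * real (c v)) \<le> ennreal K"
    by (rule ennreal_leI)
  moreover have "total_cost I R = ennreal (\<Sum>v\<in>jobs I. weight I v * real (c v))"
    using I fin by (rule total_cost_eq_finite)
  ultimately show ?thesis by simp
qed

section \<open>Passing to the optimum\<close>

lemma total_cost_le_feasible:
  assumes I: "out_forest_instance I" and R: "feasible m I R" and Q: "feasible m I Q"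
    and "1 \<le> m" "0 \<le> \<rho>"
    and slow: "\<And>t j. 1 \<le> t \<Longrightarrow> j \<in> front I R t \<Longrightarrow> R t j < 1 \<Longrightarrow>
       real m * (total_weight I (successors I j) / front_weight I R t) \<le> \<rho> * R t j"
  shows "total_cost I R \<le> ennreal (2 + 4 * \<rho>) * total_cost I Q"
proof (cases "\<exists>v\<in>jobs I. 0 < weight I v \<and> completion_time I Q v = \<infinity>")
  case True
  then have "total_cost I Q = top"
    using I total_cost_eq_top[of I _ Q] by (auto simp: out_forest_instance_def)
  then show ?thesis using \<open>0 \<le> \<rho>\<close> by (simp add: ennreal_mult_top)
next
  case False
  define c where "c v = the_enat (completion_time I Q v)" for v
  have fin: "completion_time I Q v = enat (c v)" if "v \<in> jobs I" "0 < weight I v" for v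
    using False that by (cases "completion_time I Q v") (auto simp: c_def)
  have "total_cost I R \<le> ennreal ((2 + 4 * \<rho>) * (\<Sum>v\<in>jobs I. weight I v * real (c v)))"
    by (intro total_cost_le_of_partial_sums[OF I] sum_front_weight_le[OF I R Q _ _ slow fin])
      (use assms(4,5) in auto)
  moreover have "total_cost I Q = ennreal (\<Sum>v\<in>jobs I. weight I v * real (c v))"
    using I fin by (rule total_cost_eq_finite)
  ultimately show ?thesis
    using \<open>0 \<le> \<rho>\<close> by (simp add: ennreal_mult')
qed

theorem theorem11:
  fixes A :: "'a sched_instance \<Rightarrow> nat \<Rightarrow> 'a \<Rightarrow> real"
    and pred :: "'a sched_instance \<Rightarrow> 'p"
    and m :: nat and \<rho> :: real
  assumes "1 \<le> m" and "0 \<le> \<rho>"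
    and "online_algorithm m pred A"
    and "\<And>I t j. out_forest_instance I \<Longrightarrow> 1 \<le> t \<Longrightarrow> j \<in> front I (A I) t \<Longrightarrow> A I t j < 1 \<Longrightarrow>
           real m * (total_weight I (successors I j) / front_weight I (A I) t) \<le> \<rho> * A I t j"
  shows "competitive m A (2 + 4 * \<rho>)"
  unfolding competitive_def
proof (intro allI impI)
  fix I :: "'a sched_instance" assume I: "out_forest_instance I"
  then have R: "feasible m I (A I)" using assms(3) by (simp add: online_algorithm_def)
  have c: "ennreal (2 + 4 * \<rho>) \<noteq> 0" "ennreal (2 + 4 * \<rho>) \<noteq> top"
    using assms(2) by (auto simp: ennreal_eq_0_iff)
  \<comment> \<open>Dividing by the constant isolates \<open>opt m I\<close>, so each
    \<open>Q\<close> under the infimum can be treated separately; the constant is finite and nonzero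
    and can be multiplied back.\<close>
  have "total_cost I (A I) / ennreal (2 + 4 * \<rho>) \<le> opt m I"
    unfolding opt_def
  proof (rule INF_greatest)
    fix Q assume "Q \<in> {R. feasible m I R}"
    then have "total_cost I (A I) \<le> ennreal (2 + 4 * \<rho>) * total_cost I Q"
      using assms by (intro total_cost_le_feasible[OF I R]) (auto simp: I)
    then show "total_cost I (A I) / ennreal (2 + 4 * \<rho>) \<le> total_cost I Q"
      using c by (intro divide_le_posI_ennreal) (auto simp: mult.commute zero_less_iff_neq_zero)
  qed
  then have "ennreal (2 + 4 * \<rho>) * (total_cost I (A I) / ennreal (2 + 4 * \<rho>))
      \<le> ennreal (2 + 4 * \<rho>) * opt m I"
    by (rule mult_left_mono) simp
  then show "total_cost I (A I) \<le> ennreal (2 + 4 * \<rho>) * opt m I"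
    using c by (simp add: ennreal_times_divide mult_divide_eq_ennreal mult.commute)
qed

end
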